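(* Let $\mathbf t=(t_0,u_0,t_1,u_1)\in\mathbb C^4$ with $t_0,t_1\neq 0$, let $\mathcal W$ be the group generated by $s_0,s_1$ subject to $s_0^2=s_1^2=1$, and put $\sigma_i=t_is_i\in\mathbb C[\mathcal W]$ for $i=0,1$. Then the assignment $\sigma_i\mapsto T_i$, $i=0,1$, extends uniquely to an algebra homomorphism $\pi_{\mathbf t}:\mathbb C[\mathcal W]\to\mathrm{End}(\mathcal A)$.
   Context: $\mathcal A=\mathbb C[x]$ is the algebra of polynomials in one variable, and $\mathrm{End}(\mathcal A)$ is its algebra of $\mathbb C$-linear endomorphisms. $\mathbb C[\mathcal W]$ is the group algebra of $\mathcal W$. The linear operators $T_0,T_1$ on $\mathcal A$ are $$(T_0f)(x)=t_0f(x)+\frac{(t_0+u_0+\frac12-x)(t_0-u_0+\frac12-x)}{1-2x}\big(f(1-x)-f(x)\big),$$ $$(T_1f)(x)=t_1f(x)+\frac{(t_1+u_1+x)(t_1-u_1+x)}{2x}\big(f(-x)-f(x)\big);$$ they map $\mathcal A$ into itself. *)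

theory Defs
  imports "HOL-Library.Poly_Mapping" "HOL-Computational_Algebra.Polynomial"
begin

section \<open>Groups given by generators and relations\<close>

text \<open>The letter \<open>(g, True)\<close> stands for the generator \<open>g\<close> and \<open>(g, False)\<close> for its formal
  inverse. The relation below is the congruence on words whose quotient is the group generated
  by the letters subject to \<open>r = 1\<close> for all \<open>r \<in> R\<close>.\<close>

type_synonym 'g word = "('g \<times> bool) list"

inductive pres_eq :: "'g word set \<Rightarrow> 'g word \<Rightarrow> 'g word \<Rightarrow> bool" for R :: "'g word set" where
  pres_refl: "pres_eq R u u"
| pres_sym: "pres_eq R u v \<Longrightarrow> pres_eq R v u"
| pres_trans: "pres_eq R u v \<Longrightarrow> pres_eq R v w \<Longrightarrow> pres_eq R u w"
| pres_context: "pres_eq R u v \<Longrightarrow> pres_eq R (a @ u @ b) (a @ v @ b)"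
| pres_cancel: "pres_eq R [(g, e), (g, \<not> e)] []"
| pres_rel: "r \<in> R \<Longrightarrow> pres_eq R r []"

definition inv_word :: "'g word \<Rightarrow> 'g word" where
  "inv_word w = rev (map (\<lambda>(g, e). (g, \<not> e)) w)"

lemma inv_word_append: "inv_word (u @ v) = inv_word v @ inv_word u"
  by (simp add: inv_word_def)

lemma equivp_pres_eq: "equivp (pres_eq R)"
  by (rule equivpI) (auto intro!: reflpI sympI transpI intro: pres_eq.intros)

lemma pres_eq_append:
  assumes "pres_eq R u u'" "pres_eq R v v'"
  shows "pres_eq R (u @ v) (u' @ v')"
  using pres_context[OF assms(1), of "[]" v] pres_context[OF assms(2), of u' "[]"]
  by (auto intro: pres_trans)

lemma pres_eq_inv_left: "pres_eq R (inv_word w @ w) []"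
proof (induction w)
  case Nil
  then show ?case by (simp add: inv_word_def pres_refl)
next
  case (Cons x w)
  obtain g e where x: "x = (g, e)" by (cases x)
  have "pres_eq R (inv_word w @ [(g, \<not> e), (g, e)] @ w) (inv_word w @ [] @ w)"
    using pres_cancel[of R g "\<not> e"] by (intro pres_context) simp
  with Cons x show ?case by (auto simp: inv_word_def intro: pres_trans)
qed

lemma pres_eq_inv_word:
  assumes "pres_eq R u v"
  shows "pres_eq R (inv_word u) (inv_word v)"
  using assms
proof induction
  case (pres_context u v a b)
  then show ?case by (simp add: inv_word_append pres_eq.pres_context)
next
  case (pres_cancel g e)
  show ?case using pres_eq.pres_cancel[of R g e] by (simp add: inv_word_def)
next
  case (pres_rel r)
  have "pres_eq R (inv_word r @ r) (inv_word r @ [])"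
    by (intro pres_eq_append pres_eq.pres_refl pres_eq.pres_rel pres_rel)
  then have "pres_eq R (inv_word r) (inv_word r @ r)"
    by (simp add: pres_eq.pres_sym)
  then show ?case
    using pres_eq_inv_left pres_eq.pres_trans by (fastforce simp: inv_word_def)
qed (auto intro: pres_eq.intros)

section \<open>The group W and its group algebra\<close>

datatype gen = S0 | S1

quotient_type W = "gen word" /
  "pres_eq {[(S0, True), (S0, True)], [(S1, True), (S1, True)]}"
  by (rule equivp_pres_eq)

text \<open>The (noncommutative) group W is written additively, so that the convolution product of
  \<^typ>\<open>W \<Rightarrow>\<^sub>0 complex\<close> from the library is the product of the group algebra of W over the
  complex numbers; its unit is \<open>single 0 1\<close>.\<close>

instantiation W :: group_add
begin

lift_definition zero_W :: W is "[]" .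

lift_definition plus_W :: "W \<Rightarrow> W \<Rightarrow> W" is "(@)"
  by (rule pres_eq_append)

lift_definition uminus_W :: "W \<Rightarrow> W" is inv_word
  by (rule pres_eq_inv_word)

definition minus_W :: "W \<Rightarrow> W \<Rightarrow> W" where
  "minus_W a b = a + - b"

instance
proof
  fix a b c :: W
  show "a + b + c = a + (b + c)" by transfer (simp add: pres_refl)
  show "0 + a = a" by transfer (simp add: pres_refl)
  show "a + 0 = a" by transfer (simp add: pres_refl)
  show "- a + a = 0" by transfer (rule pres_eq_inv_left)
  show "a + - b = a - b" by (simp add: minus_W_def)
qed

end

lift_definition s0 :: W is "[(S0, True)]" .
lift_definition s1 :: W is "[(S1, True)]" .

type_synonym group_algebra_W = "W \<Rightarrow>\<^sub>0 complex"

definition ga_scale :: "complex \<Rightarrow> group_algebra_W \<Rightarrow> group_algebra_W" where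
  "ga_scale c a = Poly_Mapping.map ((*) c) a"

definition sigma0 :: "complex \<Rightarrow> group_algebra_W" where
  "sigma0 t0 = ga_scale t0 (Poly_Mapping.single s0 1)"

definition sigma1 :: "complex \<Rightarrow> group_algebra_W" where
  "sigma1 t1 = ga_scale t1 (Poly_Mapping.single s1 1)"

section \<open>Endomorphisms of the polynomial algebra\<close>

definition End_A :: "(complex poly \<Rightarrow> complex poly) set" where
  "End_A = {F. Vector_Spaces.linear smult smult F}"

definition algebra_hom_End :: "(group_algebra_W \<Rightarrow> complex poly \<Rightarrow> complex poly) \<Rightarrow> bool" where
  "algebra_hom_End \<pi> \<longleftrightarrow>
     (\<forall>a. \<pi> a \<in> End_A) \<and>
     (\<forall>a b. \<pi> (a + b) = (\<lambda>f. \<pi> a f + \<pi> b f)) \<and>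
     (\<forall>c a. \<pi> (ga_scale c a) = (\<lambda>f. smult c (\<pi> a f))) \<and>
     (\<forall>a b. \<pi> (a * b) = \<pi> a \<circ> \<pi> b) \<and>
     \<pi> 1 = id"

section \<open>The operators\<close>

text \<open>The divisions are exact, so \<open>div\<close> is the quotient of polynomials occurring in the
  formulas for the operators; see \<open>poly_T0\<close> and \<open>poly_T1\<close> for the pointwise formulas.\<close>

definition T0 :: "complex \<Rightarrow> complex \<Rightarrow> complex poly \<Rightarrow> complex poly" where
  "T0 t0 u0 f = smult t0 f +
     ([:t0 + u0 + 1/2, -1:] * [:t0 - u0 + 1/2, -1:] * (f \<circ>\<^sub>p [:1, -1:] - f)) div [:1, -2:]"

definition T1 :: "complex \<Rightarrow> complex \<Rightarrow> complex poly \<Rightarrow> complex poly" where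
  "T1 t1 u1 f = smult t1 f +
     ([:t1 + u1, 1:] * [:t1 - u1, 1:] * (f \<circ>\<^sub>p [:0, -1:] - f)) div [:0, 2:]"

lemma T0_dvd: "[:1, -2:] dvd f \<circ>\<^sub>p [:1, -1:] - f" for f :: "complex poly"
proof -
  have "[:- (1/2), 1:] dvd f \<circ>\<^sub>p [:1, -1:] - f"
    by (subst poly_eq_0_iff_dvd[symmetric]) (simp add: poly_pcompose)
  then have "smult (-2) [:- (1/2), 1:] dvd f \<circ>\<^sub>p [:1, -1:] - f"
    by (rule smult_dvd) simp
  then show ?thesis by simp
qed

lemma T1_dvd: "[:0, 2:] dvd f \<circ>\<^sub>p [:0, -1:] - f" for f :: "complex poly"
proof -
  have "[:- 0, 1:] dvd f \<circ>\<^sub>p [:0, -1:] - f"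
    by (subst poly_eq_0_iff_dvd[symmetric]) (simp add: poly_pcompose)
  then have "smult 2 [:- 0, 1:] dvd f \<circ>\<^sub>p [:0, -1:] - f"
    by (rule smult_dvd) simp
  then show ?thesis by simp
qed

lemma poly_div_exact:
  fixes p q :: "complex poly"
  assumes "q dvd p" "poly q x \<noteq> 0"
  shows "poly (p div q) x = poly p x / poly q x"
  using assms by (auto elim!: dvdE)

lemma poly_T0:
  assumes "1 - 2 * x \<noteq> 0"
  shows "poly (T0 t0 u0 f) x = t0 * poly f x +
    (t0 + u0 + 1/2 - x) * (t0 - u0 + 1/2 - x) / (1 - 2 * x) * (poly f (1 - x) - poly f x)"
proof -
  have "poly [:1, -2:] x \<noteq> 0" using assms by (simp add: mult.commute)
  note div = poly_div_exact[OF dvd_mult[OF T0_dvd] this]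
  show ?thesis
    unfolding T0_def poly_add div poly_mult by (simp add: poly_pcompose mult.commute)
qed

lemma poly_T1:
  assumes "x \<noteq> 0"
  shows "poly (T1 t1 u1 f) x = t1 * poly f x +
    (t1 + u1 + x) * (t1 - u1 + x) / (2 * x) * (poly f (- x) - poly f x)"
proof -
  have "poly [:0, 2:] x \<noteq> 0" using assms by simp
  note div = poly_div_exact[OF dvd_mult[OF T1_dvd] this]
  show ?thesis
    unfolding T1_def poly_add div poly_mult by (simp add: poly_pcompose mult.commute)
qed

end

theory Submission
  imports Defs
begin

text \<open>Write \<open>T_i = t_i + A (s - 1)\<close>, where \<open>s\<close> is the involution of the polynomial algebra
  induced by \<open>x \<mapsto> 1 - x\<close> or \<open>x \<mapsto> - x\<close>. The rational function \<open>A\<close> satisfies \<open>A + s A = 2 t_i\<close>,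
  which gives \<open>T_i\<^sup>2 = t_i\<^sup>2\<close>. So the operators \<open>T_i / t_i\<close> are involutions and define a
  representation of \<open>W\<close>, which extends linearly to the group algebra. Uniqueness holds because
  \<open>s0\<close> and \<open>s1\<close> generate \<open>W\<close> and the elements of \<open>W\<close> span the group algebra.\<close>

section \<open>The quadratic relations\<close>

text \<open>A nonzero difference would have only finitely many roots. This allows operators to be
  compared away from their poles, where the pointwise formulas hold.\<close>

lemma poly_eqI_cofinite:
  fixes p q :: "complex poly"
  assumes "finite S" "\<And>x. x \<notin> S \<Longrightarrow> poly p x = poly q x"
  shows "p = q"
proof (rule ccontr)
  assume "p \<noteq> q"
  then have "finite {x. poly (p - q) x = 0}"
    by (intro poly_roots_finite) simp
  moreover have "UNIV = S \<union> {x. poly (p - q) x = 0}"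
    using assms(2) by auto
  ultimately show False
    using assms(1) infinite_UNIV_char_0[where 'a = complex] by (metis finite_UnI)
qed

text \<open>Here \<open>f\<close>, \<open>g\<close> are the values of a polynomial at a point and at
  its mirror image, and \<open>A\<close>, \<open>B\<close> the coefficients of the operator there;
  the left side is the operator applied twice.\<close>

lemma reflection_operator_square:
  fixes t :: "'a :: comm_ring_1"
  assumes "A + B = 2 * t"
  shows "t * (t * f + A * (g - f)) + A * ((t * g + B * (f - g)) - (t * f + A * (g - f))) = t ^ 2 * f"
proof -
  have B: "B = 2 * t - A"
    using assms by (simp add: algebra_simps)
  show ?thesis
    unfolding B by (simp add: algebra_simps power2_eq_square)
qed

lemma T0_T0: "T0 t u (T0 t u f) = smult (t ^ 2) f"
proof (rule poly_eqI_cofinite)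
  fix x :: complex
  assume "x \<notin> {1/2}"
  then have x: "1 - 2 * x \<noteq> 0" and x': "1 - 2 * (1 - x) \<noteq> 0"
    by (auto simp: field_simps)
  have x'': "1 - (1 - x) = x"
    by simp
  define A where "A = (t + u + 1/2 - x) * (t - u + 1/2 - x) / (1 - 2 * x)"
  define B where "B = (t + u + 1/2 - (1 - x)) * (t - u + 1/2 - (1 - x)) / (1 - 2 * (1 - x))"
  \<comment> \<open>The reflection negates the denominator \<open>1 - 2 * x\<close>, so
    \<open>A\<close> and \<open>B\<close> get a common one.\<close>
  have "B = - ((t + u + 1/2 - (1 - x)) * (t - u + 1/2 - (1 - x))) / (1 - 2 * x)"
    unfolding B_def using x x' by (simp add: divide_simps) (simp add: algebra_simps)
  then have "A + B = 2 * t"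
    unfolding A_def using x by (simp add: divide_simps) (simp add: algebra_simps)
  from reflection_operator_square[OF this]
  show "poly (T0 t u (T0 t u f)) x = poly (smult (t ^ 2) f) x"
    by (simp only: poly_T0[OF x] poly_T0[OF x'] x'' poly_smult flip: A_def B_def)
qed simp

lemma T1_T1: "T1 t u (T1 t u f) = smult (t ^ 2) f"
proof (rule poly_eqI_cofinite)
  fix x :: complex
  assume "x \<notin> {0}"
  then have x: "x \<noteq> 0" and x': "- x \<noteq> 0"
    by auto
  define A where "A = (t + u + x) * (t - u + x) / (2 * x)"
  define B where "B = (t + u + - x) * (t - u + - x) / (2 * - x)"
  have "A + B = 2 * t"
    unfolding A_def B_def using x by (simp add: divide_simps) (simp add: algebra_simps)
  from reflection_operator_square[OF this]
  show "poly (T1 t u (T1 t u f)) x = poly (smult (t ^ 2) f) x"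
    by (simp only: poly_T1[OF x] poly_T1[OF x'] minus_minus poly_smult flip: A_def B_def)
qed simp

section \<open>Linearity of the operators\<close>

lemma linear_smultI:
  assumes "\<And>f g. F (f + g) = F f + F g" "\<And>c f. F (smult c f) = smult c (F f)"
  shows "Vector_Spaces.linear smult smult (F :: complex poly \<Rightarrow> complex poly)"
  by unfold_locales (simp_all add: assms smult_add_right smult_add_left)

lemma linear_smultD:
  assumes "Vector_Spaces.linear smult smult F"
  shows "F (f + g) = F f + F g" "F (smult c f) = smult c (F f)"
  using assms unfolding Vector_Spaces.linear_iff by simp_all

text \<open>Off the pole the value is linear in the values of \<open>f\<close> at \<open>x\<close>
  and \<open>1 - x\<close>; this avoids reasoning about \<open>div\<close>.\<close>

lemma T0_linear: "Vector_Spaces.linear smult smult (T0 t u)"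
proof (rule linear_smultI; rule poly_eqI_cofinite[of "{1/2}"])
  fix f g and c x :: complex
  assume "x \<notin> {1/2}"
  then have x: "1 - 2 * x \<noteq> 0"
    by (auto simp: field_simps)
  show "poly (T0 t u (f + g)) x = poly (T0 t u f + T0 t u g) x"
    unfolding poly_add poly_T0[OF x] by (simp only: algebra_simps)
  show "poly (T0 t u (smult c f)) x = poly (smult c (T0 t u f)) x"
    unfolding poly_smult poly_T0[OF x] by (simp only: algebra_simps)
qed simp_all

lemma T1_linear: "Vector_Spaces.linear smult smult (T1 t u)"
proof (rule linear_smultI; rule poly_eqI_cofinite[of "{0}"])
  fix f g and c x :: complex
  assume "x \<notin> {0}"
  then have x: "x \<noteq> 0"
    by auto
  show "poly (T1 t u (f + g)) x = poly (T1 t u f + T1 t u g) x"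
    unfolding poly_add poly_T1[OF x] by (simp only: algebra_simps)
  show "poly (T1 t u (smult c f)) x = poly (smult c (T1 t u f)) x"
    unfolding poly_smult poly_T1[OF x] by (simp only: algebra_simps)
qed simp_all

section \<open>Representations of the group and of its group algebra\<close>

text \<open>A generator and its formal inverse act in the same way, as \<open>M g\<close> will be an involution.\<close>

definition word_act :: "('g \<Rightarrow> 'a \<Rightarrow> 'a) \<Rightarrow> 'g word \<Rightarrow> 'a \<Rightarrow> 'a" where
  "word_act M w = foldr (\<lambda>(g, e). M g) w"

lemma word_act_simps [simp]:
  "word_act M [] = id"
  "word_act M ((g, e) # w) = M g \<circ> word_act M w"
  "word_act M (v @ w) = word_act M v \<circ> word_act M w"
  by (simp_all add: word_act_def fun_eq_iff)

lemma word_act_cong: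
  assumes "\<And>g. M g \<circ> M g = id" "\<And>r. r \<in> R \<Longrightarrow> word_act M r = id" "pres_eq R v w"
  shows "word_act M v = word_act M w"
  using assms(3) by induction (simp_all add: assms(1,2))

text \<open>A chosen representative is used instead of lifting, since independence of the choice
  requires each \<open>M g\<close> to be an involution.\<close>

definition W_act :: "(gen \<Rightarrow> 'a \<Rightarrow> 'a) \<Rightarrow> W \<Rightarrow> 'a \<Rightarrow> 'a" where
  "W_act M w = word_act M (rep_W w)"

lemma W_act_abs:
  assumes "\<And>g. M g \<circ> M g = id"
  shows "W_act M (abs_W w) = word_act M w"
  unfolding W_act_def
  by (rule word_act_cong[OF assms _ Quotient3_rep_abs[OF Quotient3_W pres_refl]])
    (auto simp: assms)

lemma W_act:
  assumes "\<And>g. M g \<circ> M g = id"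
  shows "W_act M 0 = id" "W_act M (v + w) = W_act M v \<circ> W_act M w"
    "W_act M s0 = M S0" "W_act M s1 = M S1"
proof -
  have "v + w = abs_W (rep_W v @ rep_W w)"
    by (metis Quotient3_W Quotient3_abs_rep plus_W.abs_eq)
  then show "W_act M (v + w) = W_act M v \<circ> W_act M w"
    by (simp add: W_act_abs[OF assms]) (simp add: W_act_def)
qed (simp_all add: W_act_abs[OF assms] zero_W_def s0_def s1_def)

lemma W_act_linear:
  fixes M :: "gen \<Rightarrow> complex poly \<Rightarrow> complex poly"
  assumes "\<And>g. Vector_Spaces.linear smult smult (M g)"
  shows "Vector_Spaces.linear smult smult (W_act M w)"
proof -
  have "Vector_Spaces.linear smult smult (word_act M v)" for v
  proof (induction v)
    case Nil
    show ?case
      by (rule linear_smultI) simp_all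
  next
    case (Cons x v)
    obtain g e where x: "x = (g, e)"
      by (cases x)
    show ?case
      unfolding x word_act_simps by (rule Vector_Spaces.linear_compose[OF Cons assms])
  qed
  then show ?thesis
    by (simp add: W_act_def)
qed

section \<open>Linear extension to the group algebra\<close>

lemma poly_mapping_additive_induct [case_names zero add]:
  assumes "P 0" "\<And>a k c. P a \<Longrightarrow> P (a + Poly_Mapping.single k c)"
  shows "P (a :: 'k \<Rightarrow>\<^sub>0 'c :: monoid_add)"
proof (induction a rule: update_induct)
  case const
  show ?case by (rule assms(1))
next
  case (update a k c)
  \<comment> \<open>The key \<open>k\<close> is fresh, so its old coefficient is 0 and overwriting
    it amounts to adding.\<close>
  have "Poly_Mapping.update k c a = a + Poly_Mapping.single k c"
    using update(1) by (intro poly_mapping_eqI)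
      (auto simp: lookup_update lookup_add lookup_single when_def in_keys_iff)
  then show ?case
    using assms(2)[OF update(3)] by (simp only:)
qed

lemma ga_scale_conv_mult: "ga_scale c a = Poly_Mapping.single 0 c * a"
  by (simp add: ga_scale_def mult_map_scale_conv_mult)

definition lin_ext :: "('k \<Rightarrow> 'a \<Rightarrow> 'b poly) \<Rightarrow> ('k \<Rightarrow>\<^sub>0 'b) \<Rightarrow> 'a \<Rightarrow> 'b :: comm_ring_1 poly" where
  "lin_ext \<phi> a f = (\<Sum>k\<in>Poly_Mapping.keys a. smult (Poly_Mapping.lookup a k) (\<phi> k f))"

text \<open>Cancellation may remove keys from \<open>a + b\<close>, which is harmless because zero
  coefficients contribute nothing.\<close>

lemma lin_ext_add: "lin_ext \<phi> (a + b) f = lin_ext \<phi> a f + lin_ext \<phi> b f"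
  unfolding lin_ext_def
  by (rule setsum_keys_plus_distrib) (simp_all add: smult_add_left)

lemma lin_ext_single [simp]: "lin_ext \<phi> (Poly_Mapping.single k c) f = smult c (\<phi> k f)"
  by (simp add: lin_ext_def)

lemma lin_ext_zero [simp]: "lin_ext \<phi> 0 f = 0"
  by (simp add: lin_ext_def)

text \<open>Both sides are additive in \<open>a\<close> and in \<open>b\<close>, so nested
  inductions reduce the claim to single terms, where it is multiplicativity of
  \<open>\<phi>\<close>.\<close>

lemma lin_ext_mult:
  fixes \<phi> :: "'k :: monoid_add \<Rightarrow> 'b :: comm_ring_1 poly \<Rightarrow> 'b poly"
  assumes "\<And>k l f. \<phi> (k + l) f = \<phi> k (\<phi> l f)"
    and "\<And>k f g. \<phi> k (f + g) = \<phi> k f + \<phi> k g" "\<And>k c f. \<phi> k (smult c f) = smult c (\<phi> k f)"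
  shows "lin_ext \<phi> (a * b) f = lin_ext \<phi> a (lin_ext \<phi> b f)"
proof (induction a rule: poly_mapping_additive_induct)
  case (add a k c)
  have "lin_ext \<phi> (Poly_Mapping.single k c * b) f = smult c (\<phi> k (lin_ext \<phi> b f))"
  proof (induction b rule: poly_mapping_additive_induct)
    case zero
    show ?case using assms(3)[of k 0 0] by simp
  next
    case (add b l d)
    then show ?case
      by (simp add: distrib_left lin_ext_add mult_single assms smult_add_right)
  qed
  with add show ?case
    by (simp add: distrib_right lin_ext_add)
qed simp

lemma algebra_hom_lin_ext:
  fixes M :: "gen \<Rightarrow> complex poly \<Rightarrow> complex poly"
  assumes "\<And>g. M g \<circ> M g = id" "\<And>g. Vector_Spaces.linear smult smult (M g)"
  shows "algebra_hom_End (lin_ext (W_act M))"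
proof -
  note add = linear_smultD(1)[OF W_act_linear[of M, OF assms(2)]]
    and scale = linear_smultD(2)[OF W_act_linear[of M, OF assms(2)]]
  have mult: "lin_ext (W_act M) (a * b) f = lin_ext (W_act M) a (lin_ext (W_act M) b f)" for a b f
    by (rule lin_ext_mult) (simp_all add: add scale W_act(2)[OF assms(1)])
  have "lin_ext (W_act M) a \<in> End_A" for a
    unfolding End_A_def mem_Collect_eq
    by (rule linear_smultI; induction a rule: poly_mapping_additive_induct)
      (simp_all add: lin_ext_add add scale smult_add_right mult.commute)
  moreover have "lin_ext (W_act M) 1 = id"
    by (simp add: fun_eq_iff W_act(1)[OF assms(1)] flip: single_one)
  \<comment> \<open>Scaling is multiplication by \<open>single 0 c\<close>, so its compatibility
    follows from \<open>mult\<close> and the trivial action of the neutral element.\<close>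
  ultimately show ?thesis
    unfolding algebra_hom_End_def
    by (simp add: fun_eq_iff lin_ext_add mult ga_scale_conv_mult W_act(1)[OF assms(1)])
qed

section \<open>Uniqueness\<close>

text \<open>The relations make each generator its own inverse, so inverse letters can be replaced
  and every element is a product of \<open>s0\<close> and \<open>s1\<close>.\<close>

lemma W_induct [case_names zero s0 s1]:
  assumes "P 0" "\<And>w. P w \<Longrightarrow> P (s0 + w)" "\<And>w. P w \<Longrightarrow> P (s1 + w)"
  shows "P w"
proof -
  define R where "R = {[(S0, True), (S0, True)], [(S1, True), (S1, True)]}"
  have inv: "pres_eq R [(g, False)] [(g, True)]" for g
  proof -
    have "[(g, True), (g, True)] \<in> R"
      by (cases g) (simp_all add: R_def)
    \<comment> \<open>The word for the inverse of \<open>g\<close> followed by \<open>g\<close>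
      twice is reduced in two ways: by the relator and by free cancellation.\<close>
    then have "pres_eq R ([(g, False)] @ [(g, True), (g, True)]) ([(g, False)] @ [])"
      by (intro pres_eq_append pres_refl pres_rel)
    moreover have "pres_eq R ([(g, False), (g, \<not> False)] @ [(g, True)]) ([] @ [(g, True)])"
      by (intro pres_eq_append pres_refl pres_cancel)
    ultimately show ?thesis
      by (auto intro: pres_sym pres_trans)
  qed
  have "P (abs_W v)" for v
  proof (induction v)
    case Nil
    then show ?case using assms(1) by (simp add: zero_W_def)
  next
    case (Cons x v)
    obtain g e where x: "x = (g, e)"
      by (cases x)
    have "pres_eq R ([(g, e)] @ v) ([(g, True)] @ v)"
      using inv by (intro pres_eq_append) (cases e; simp add: pres_refl)+
    then have "abs_W (x # v) = abs_W ([(g, True)] @ v)"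
      by (simp add: W.abs_eq_iff R_def x)
    also have "\<dots> = (case g of S0 \<Rightarrow> s0 | S1 \<Rightarrow> s1) + abs_W v"
      by (cases g) (simp_all add: s0_def s1_def plus_W.abs_eq)
    finally show ?case
      using Cons assms(2,3) by (cases g) simp_all
  qed
  then show ?thesis
    by (metis Quotient3_W Quotient3_abs_rep)
qed

text \<open>Multiplicativity spreads the agreement from the generators to all group elements, and
  linearity from these to their span.\<close>

lemma algebra_hom_eqI:
  assumes \<pi>: "algebra_hom_End \<pi>" and \<rho>: "algebra_hom_End \<rho>"
    and eq: "\<pi> (Poly_Mapping.single s0 1) = \<rho> (Poly_Mapping.single s0 1)"
      "\<pi> (Poly_Mapping.single s1 1) = \<rho> (Poly_Mapping.single s1 1)"
  shows "\<pi> = \<rho>"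
proof
  fix a
  have hom: "\<tau> (a + b) = (\<lambda>f. \<tau> a f + \<tau> b f)" "\<tau> (ga_scale c a) = (\<lambda>f. smult c (\<tau> a f))"
    "\<tau> (a * b) = \<tau> a \<circ> \<tau> b" "\<tau> 1 = id" if "\<tau> \<in> {\<pi>, \<rho>}" for \<tau> a b c
    using \<pi> \<rho> that unfolding algebra_hom_End_def by auto
  have single: "\<pi> (Poly_Mapping.single w 1) = \<rho> (Poly_Mapping.single w 1)" for w
  proof (induction w rule: W_induct)
    case zero
    show ?case by (simp add: hom(4))
  next
    case (s0 w)
    have "Poly_Mapping.single (Defs.s0 + w) (1 :: complex) =
        Poly_Mapping.single Defs.s0 1 * Poly_Mapping.single w 1"
      by (simp add: mult_single)
    with s0 eq(1) show ?case by (simp add: hom(3))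
  next
    case (s1 w)
    have "Poly_Mapping.single (Defs.s1 + w) (1 :: complex) =
        Poly_Mapping.single Defs.s1 1 * Poly_Mapping.single w 1"
      by (simp add: mult_single)
    with s1 eq(2) show ?case by (simp add: hom(3))
  qed
  have single_c: "Poly_Mapping.single w c = ga_scale c (Poly_Mapping.single w 1)" for w c
    by (simp add: ga_scale_conv_mult mult_single)
  show "\<pi> a = \<rho> a"
  proof (induction a rule: poly_mapping_additive_induct)
    case zero
    \<comment> \<open>The value at 0 is obtained from homogeneity with scalar 0.\<close>
    have "0 = ga_scale 0 0"
      by (simp add: ga_scale_conv_mult)
    then show ?case
      using hom(2)[of _ 0 0] by (metis (no_types) insertCI smult_0_left)
  next
    case (add a w c)
    then show ?case
      by (simp add: hom(1) single_c[of w c] hom(2) single)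
  qed
qed

theorem proposition2p4:
  fixes t0 u0 t1 u1 :: complex
  assumes "t0 \<noteq> 0" and "t1 \<noteq> 0"
  shows "\<exists>!\<pi>. algebra_hom_End \<pi> \<and>
    \<pi> (sigma0 t0) = T0 t0 u0 \<and> \<pi> (sigma1 t1) = T1 t1 u1"
proof -
  \<comment> \<open>\<open>M\<close> gives the intended images of \<open>s0\<close> and
    \<open>s1\<close>; dividing by \<open>t0\<close> and \<open>t1\<close> turns the quadratic
    relations into involutivity.\<close>
  define M where "M g f = (case g of S0 \<Rightarrow> smult (1 / t0) (T0 t0 u0 f)
    | S1 \<Rightarrow> smult (1 / t1) (T1 t1 u1 f))" for g f
  note lin = linear_smultD[OF T0_linear] linear_smultD[OF T1_linear]
  have M_linear: "Vector_Spaces.linear smult smult (M g)" for g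
    by (intro linear_smultI; cases g) (simp_all add: M_def lin smult_add_right mult.commute)
  have M_inv: "M g \<circ> M g = id" for g
    using assms
    by (cases g) (simp_all add: fun_eq_iff M_def lin T0_T0 T1_T1 power2_eq_square)
  have sigma: "\<pi> (sigma0 t0) = (\<lambda>f. smult t0 (\<pi> (Poly_Mapping.single s0 1) f))"
    "\<pi> (sigma1 t1) = (\<lambda>f. smult t1 (\<pi> (Poly_Mapping.single s1 1) f))" if "algebra_hom_End \<pi>" for \<pi>
    using that by (simp_all add: algebra_hom_End_def sigma0_def sigma1_def)
  have M_hom: "algebra_hom_End (lin_ext (W_act M))"
    by (rule algebra_hom_lin_ext[OF M_inv M_linear])
  show ?thesis
  proof (rule ex1I[of _ "lin_ext (W_act M)"])
    show "algebra_hom_End (lin_ext (W_act M)) \<and> lin_ext (W_act M) (sigma0 t0) = T0 t0 u0 \<and>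
        lin_ext (W_act M) (sigma1 t1) = T1 t1 u1"
      using assms
      by (simp add: M_hom sigma[OF M_hom] fun_eq_iff W_act(3,4)[OF M_inv] M_def)
  next
    fix \<pi>
    assume \<pi>: "algebra_hom_End \<pi> \<and> \<pi> (sigma0 t0) = T0 t0 u0 \<and> \<pi> (sigma1 t1) = T1 t1 u1"
    then have hom: "algebra_hom_End \<pi>"
      and T: "T0 t0 u0 = \<pi> (sigma0 t0)" "T1 t1 u1 = \<pi> (sigma1 t1)"
      by simp_all
    \<comment> \<open>Rewriting each operator as a multiple of the image of \<open>s0\<close> or
      \<open>s1\<close> lets the nonzero scalar cancel, so both maps agree on the
      generators.\<close>
    show "\<pi> = lin_ext (W_act M)"
      using assms
      by (intro algebra_hom_eqI[OF hom M_hom])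
        (simp_all add: fun_eq_iff W_act(3,4)[OF M_inv] M_def T sigma[OF hom])
  qed
qed

end
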